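(* Let $L$ be a finite rank nondegenerate even lattice that is not positive-definite and let $V_L$ be the associated vertex algebra. Then $C_{n+2}(V_L)=E_n(V_L)=V_L$ for all $n\ge 0$. Furthermore, there does not exist a lower truncated $\mathbb{Z}$-grading on $V_L$ with which $V_L$ becomes a lower truncated $\mathbb{Z}$-graded vertex algebra.
   Context: Vector spaces are over $\mathbb{C}$. For a vertex algebra $V$ with vacuum $\mathbf{1}$ write $Y(u,x)=\sum_{n\in\mathbb{Z}}u_nx^{-n-1}$. An even lattice $L$ is a free abelian group of finite rank with a symmetric $\mathbb{Z}$-valued bilinear form $\langle\cdot,\cdot\rangle$ with $\langle\alpha,\alpha\rangle\in 2\mathbb{Z}$; it is positive-definite if $\langle\alpha,\alpha\rangle>0$ for all $0\ne\alpha\in L$. $V_L$ is the standard lattice vertex algebra: with $\mathfrak{h}=\mathbb{C}\otimes_{\mathbb{Z}}L$ and $\varepsilon:L\times L\to\{\pm1\}$ a bimultiplicative cocycle with $\varepsilon(\alpha,\beta)\varepsilon(\beta,\alpha)=(-1)^{\langle\alpha,\beta\rangle}$, $V_L=S(\mathfrak{h}\otimes t^{-1}\mathbb{C}[t^{-1}])\otimes\mathbb{C}_\varepsilon[L]$, where $\mathbb{C}_\varepsilon[L]$ has basis $e^\alpha$ ($\alpha\in L$) and $e_\alpha e^\beta=\varepsilon(\alpha,\beta)e^{\alpha+\beta}$. Here $h(n)=h\otimes t^n$ acts as Heisenberg operators, $[h(m),h'(n)]=m\langle h,h'\rangle\delta_{m+n,0}$, with $h(n)e^\beta=0$ for $n>0$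 and $h(0)e^\beta=\langle h,\beta\rangle e^\beta$. The vacuum is $\mathbf{1}=e^0$, $Y(h(-1)\mathbf{1},x)=\sum_n h(n)x^{-n-1}$, and $Y(e^\alpha,x)=\exp\big(\sum_{n\ge1}\frac{\alpha(-n)}{n}x^n\big)\exp\big(-\sum_{n\ge1}\frac{\alpha(n)}{n}x^{-n}\big)e_\alpha x^{\alpha}$ with $x^\alpha e^\beta=x^{\langle\alpha,\beta\rangle}e^\beta$. A $\mathbb{Z}$-graded vertex algebra is a vertex algebra with a grading $V=\coprod_{n\in\mathbb{Z}}V_{(n)}$ such that $\mathbf{1}\in V_{(0)}$ and $u_mV_{(n)}\subset V_{(n+k-m-1)}$ for $u\in V_{(k)}$, $k,m,n\in\mathbb{Z}$; it is lower truncated if $V_{(n)}=0$ for $n$ sufficiently small. For $n\in\mathbb{Z}$, $E_n(V)$ is the linear span of the vectors $u^{(1)}_{-1-k_1}\cdots u^{(r)}_{-1-k_r}v$ for $r\ge 1$, $u^{(i)},v\in V$, $k_i\ge 0$ with $k_1+\cdots+k_r\ge n$. For $n\ge 2$, $C_n(V)$ is the linear span of the vectors $u_{-n}v$ for $u,v\in V$. *)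

theory Defs
  imports
    "HOL-Analysis.Finite_Cartesian_Product"
    "HOL-Library.Poly_Mapping"
    "HOL-Library.Multiset"
begin

section \<open>Vertex algebras\<close>

text \<open>
  A vertex algebra is given by its modes: \<open>prod u n v\<close> is \<open>u\<^sub>n v\<close>, where
  \<open>Y(u,x) = \<Sum>\<^sub>n u\<^sub>n x\<^sup>-\<^sup>n\<^sup>-\<^sup>1\<close>. The axiom \<open>borcherds\<close> is the Jacobi identity written out in
  components. By truncation, both sums in it have finite support, so that \<^const>\<open>Sum_any\<close>
  (which is only meaningful for finite support) denotes the intended sum.
\<close>

locale vertex_algebra = vector_space scale
  for scale :: "complex \<Rightarrow> 'v::ab_group_add \<Rightarrow> 'v" +
  fixes vac :: 'v
    and prod :: "'v \<Rightarrow> int \<Rightarrow> 'v \<Rightarrow> 'v"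
  assumes prod_add_left: "prod (u + u') n v = prod u n v + prod u' n v"
    and prod_scale_left: "prod (scale c u) n v = scale c (prod u n v)"
    and prod_add_right: "prod u n (v + v') = prod u n v + prod u n v'"
    and prod_scale_right: "prod u n (scale c v) = scale c (prod u n v)"
    and truncation: "\<exists>N. \<forall>n\<ge>N. prod u n v = 0"
    and vacuum: "prod vac n v = (if n = -1 then v else 0)"
    and creation: "prod u (-1) vac = u" "n \<ge> 0 \<Longrightarrow> prod u n vac = 0"
    and borcherds:
      "Sum_any (\<lambda>i::nat. scale (of_int m gchoose i)
           (prod (prod u (l + int i) v) (m + n - int i) w)) =
       Sum_any (\<lambda>i::nat. scale ((-1) ^ i * (of_int l gchoose i))
           (prod u (m + l - int i) (prod v (n + int i) w)
            - scale ((-1) powi l) (prod v (n + l - int i) (prod u (m + int i) w))))"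
begin

definition E_space :: "int \<Rightarrow> 'v set" where
  "E_space n = span {foldr (\<lambda>(u, k). prod u (- 1 - int k)) uks v | uks v.
      uks \<noteq> [] \<and> int (sum_list (map snd uks)) \<ge> n}"

definition C_space :: "nat \<Rightarrow> 'v set" where
  "C_space n = span {prod u (- int n) v | u v. True}"

end

locale graded_vertex_algebra = vertex_algebra scale vac prod
  for scale :: "complex \<Rightarrow> 'v::ab_group_add \<Rightarrow> 'v" and vac prod +
  fixes G :: "int \<Rightarrow> 'v set"
  assumes graded_subspace: "subspace (G n)"
    and graded_direct_sum:
      "\<exists>!f. (\<forall>n. f n \<in> G n) \<and> finite {n. f n \<noteq> 0} \<and> v = (\<Sum>n | f n \<noteq> 0. f n)"
    and vac_graded: "vac \<in> G 0"
    and prod_graded: "u \<in> G k \<Longrightarrow> v \<in> G n \<Longrightarrow> prod u m v \<in> G (n + k - m - 1)"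

locale lower_truncated_graded_vertex_algebra = graded_vertex_algebra +
  assumes lower_truncated: "\<exists>N. \<forall>n<N. G n = {0}"


section \<open>Even lattices\<close>

text \<open>
  An abelian group \<open>L\<close>, viewed as a \<open>\<int>\<close>-module, which is free of finite rank with
  \<open>\<int>\<close>-basis \<open>b\<close>.
\<close>

locale even_lattice = module zscale
  for zscale :: "int \<Rightarrow> 'l::ab_group_add \<Rightarrow> 'l" +
  fixes b :: "'n::finite \<Rightarrow> 'l"
    and form :: "'l \<Rightarrow> 'l \<Rightarrow> int"
  assumes basis_inj: "inj b"
    and basis_independent: "independent (range b)"
    and basis_span: "span (range b) = UNIV"
    and form_add: "form (\<alpha> + \<alpha>') \<beta> = form \<alpha> \<beta> + form \<alpha>' \<beta>"
    and form_sym: "form \<alpha> \<beta> = form \<beta> \<alpha>"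
    and form_even: "even (form \<alpha> \<alpha>)"

definition nondegenerate :: "('l::ab_group_add \<Rightarrow> 'l \<Rightarrow> int) \<Rightarrow> bool" where
  "nondegenerate form \<longleftrightarrow> (\<forall>\<alpha>. (\<forall>\<beta>. form \<alpha> \<beta> = 0) \<longrightarrow> \<alpha> = 0)"

definition positive_definite :: "('l::ab_group_add \<Rightarrow> 'l \<Rightarrow> int) \<Rightarrow> bool" where
  "positive_definite form \<longleftrightarrow> (\<forall>\<alpha>. \<alpha> \<noteq> 0 \<longrightarrow> form \<alpha> \<alpha> > 0)"


section \<open>The lattice vertex algebra\<close>

text \<open>
  The space \<open>S(h \<otimes> t\<^sup>-\<^sup>1\<complex>[t\<^sup>-\<^sup>1]) \<otimes> \<complex>[L]\<close>. The first factor is the polynomial algebra in the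
  variables \<open>b\<^sub>i \<otimes> t\<^sup>-\<^sup>k\<^sup>-\<^sup>1\<close> for \<open>k \<ge> 0\<close>, encoded as \<open>(i, k)\<close> (mind the shift), and a monomial is a
  multiset of variables; so the pair of \<open>M\<close> and \<open>\<beta>\<close> indexes the basis vector
  \<open>(\<Prod>(i,k)\<in>M. b\<^sub>i(-k-1)) \<otimes> e\<^sup>\<beta>\<close>.
\<close>

type_synonym ('n, 'l) fock = "(('n \<times> nat) multiset \<times> 'l) \<Rightarrow>\<^sub>0 complex"

definition fscale :: "complex \<Rightarrow> ('n, 'l) fock \<Rightarrow> ('n, 'l) fock" where
  "fscale c v = Poly_Mapping.map ((*) c) v"

lemma lookup_fscale [simp]: "Poly_Mapping.lookup (fscale c v) k = c * Poly_Mapping.lookup v k"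
  by (simp add: fscale_def Poly_Mapping.map.rep_eq when_def)

lemma vector_space_fscale: "vector_space fscale"
  by unfold_locales (auto intro!: poly_mapping_eqI simp: lookup_add algebra_simps)

definition fbasis :: "('n \<times> nat) multiset \<Rightarrow> 'l \<Rightarrow> ('n, 'l) fock" where
  "fbasis M \<beta> = Poly_Mapping.single (M, \<beta>) 1"

definition fexp :: "'l \<Rightarrow> ('n, 'l) fock" where
  "fexp \<beta> = fbasis {#} \<beta>"

definition fvac :: "('n, 'l::zero) fock" where
  "fvac = fexp 0"

definition linear_extension ::
    "(('n \<times> nat) multiset \<Rightarrow> 'l \<Rightarrow> ('n, 'l) fock) \<Rightarrow> ('n, 'l) fock \<Rightarrow> ('n, 'l) fock" where
  "linear_extension f v =
    (\<Sum>(M, \<beta>)\<in>Poly_Mapping.keys v. fscale (Poly_Mapping.lookup v (M, \<beta>)) (f M \<beta>))"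

text \<open>
  The coefficient of \<open>x\<^sup>k\<close> in \<open>exp (\<Sum>n\<ge>1. a\<^sub>n x\<^sup>n)\<close>: expanding the \<open>r\<close>-th power for each \<open>r\<close>
  gives \<open>1/r!\<close> times the sum of \<open>a\<^sub>n\<^sub>1 \<dots> a\<^sub>n\<^sub>r\<close> over all \<open>n\<^sub>1, \<dots>, n\<^sub>r \<ge> 1\<close> with
  \<open>n\<^sub>1 + \<dots> + n\<^sub>r = k\<close>.
\<close>

definition exp_coeff ::
    "(nat \<Rightarrow> ('n, 'l) fock \<Rightarrow> ('n, 'l) fock) \<Rightarrow> nat \<Rightarrow> ('n, 'l) fock \<Rightarrow> ('n, 'l) fock" where
  "exp_coeff a k v =
    (\<Sum>ns | 0 \<notin> set ns \<and> sum_list ns = k. fscale (1 / fact (length ns)) (foldr a ns v))"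

context even_lattice
begin

text \<open>
  Elements of \<open>h = \<complex> \<otimes> L\<close> are given by their coordinates with respect to the basis
  \<open>1 \<otimes> b\<^sub>i\<close>.
\<close>

definition embed :: "'l \<Rightarrow> complex ^ 'n" where
  "embed \<alpha> = (\<chi> i. of_int (representation (range b) \<alpha> (b i)))"

definition hform :: "complex ^ 'n \<Rightarrow> complex ^ 'n \<Rightarrow> complex" where
  "hform h h' = (\<Sum>i\<in>UNIV. \<Sum>j\<in>UNIV. h $ i * h' $ j * of_int (form (b i) (b j)))"

text \<open>
  The Heisenberg operator \<open>h(m)\<close>: multiplication by \<open>h \<otimes> t\<^sup>m\<close> for \<open>m < 0\<close>, and for \<open>m > 0\<close> the
  derivation sending \<open>h' \<otimes> t\<^sup>-\<^sup>m\<close> to \<open>m\<langle>h,h'\<rangle>\<close> and all other \<open>h' \<otimes> t\<^sup>-\<^sup>k\<close> to \<open>0\<close>.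
\<close>

definition heis :: "complex ^ 'n \<Rightarrow> int \<Rightarrow> ('n, 'l) fock \<Rightarrow> ('n, 'l) fock" where
  "heis h m = linear_extension (\<lambda>M \<beta>.
     if m < 0 then
       (\<Sum>i\<in>UNIV. fscale (h $ i) (fbasis (add_mset (i, nat (- m) - 1) M) \<beta>))
     else if m = 0 then fscale (hform h (embed \<beta>)) (fbasis M \<beta>)
     else
       (\<Sum>i\<in>UNIV. fscale (of_int m * hform h (embed (b i)) * of_nat (count M (i, nat m - 1)))
                     (fbasis (M - {#(i, nat m - 1)#}) \<beta>)))"

text \<open>
  The coefficients of \<open>x\<^sup>j\<close> and of \<open>x\<^sup>-\<^sup>k\<close>, respectively, in the two exponential factors of
  \<open>Y(e\<^sup>\<alpha>,x)\<close>.
\<close>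

definition exp_minus :: "'l \<Rightarrow> nat \<Rightarrow> ('n, 'l) fock \<Rightarrow> ('n, 'l) fock" where
  "exp_minus \<alpha> = exp_coeff (\<lambda>n v. fscale (1 / of_nat n) (heis (embed \<alpha>) (- int n) v))"

definition exp_plus :: "'l \<Rightarrow> nat \<Rightarrow> ('n, 'l) fock \<Rightarrow> ('n, 'l) fock" where
  "exp_plus \<alpha> = exp_coeff (\<lambda>n v. fscale (- 1 / of_nat n) (heis (embed \<alpha>) (int n) v))"

text \<open>
  The coefficient of \<open>x\<^sup>-\<^sup>n\<^sup>-\<^sup>1\<close> in \<open>Y(e\<^sup>\<alpha>,x)\<close>. On \<open>S \<otimes> e\<^sup>\<beta>\<close> the operator \<open>e\<^sub>\<alpha> x\<^sup>\<alpha>\<close> contributes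
  \<open>\<epsilon>(\<alpha>,\<beta>) x\<^sup>\<langle>\<^sup>\<alpha>\<^sup>,\<^sup>\<beta>\<^sup>\<rangle>\<close>, so one sums over all \<open>j, k \<ge> 0\<close> with \<open>j - k + \<langle>\<alpha>,\<beta>\<rangle> = - n - 1\<close>. Since
  \<open>exp_plus \<alpha> k\<close> annihilates a given vector for large \<open>k\<close>, the sum has finite support.
\<close>

definition vertex_op ::
    "('l \<Rightarrow> 'l \<Rightarrow> complex) \<Rightarrow> 'l \<Rightarrow> int \<Rightarrow> ('n, 'l) fock \<Rightarrow> ('n, 'l) fock" where
  "vertex_op \<epsilon> \<alpha> n = linear_extension (\<lambda>M \<beta>.
     Sum_any (\<lambda>(j, k). if int j - int k + form \<alpha> \<beta> = - n - 1
       then exp_minus \<alpha> j (exp_plus \<alpha> k (fscale (\<epsilon> \<alpha> \<beta>) (fbasis M (\<alpha> + \<beta>)))) else 0))"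

end

text \<open>
  The vertex algebra \<open>V\<^sub>L\<close>: the vertex algebra structure on the above space with vacuum
  \<open>e\<^sup>0\<close> and with the prescribed fields of \<open>h(-1)e\<^sup>0\<close> and \<open>e\<^sup>\<alpha>\<close>. As these vectors generate
  \<open>V\<^sub>L\<close>, they determine \<open>Y\<close>.
\<close>

locale lattice_vertex_algebra =
  even_lattice zscale b form + VL: vertex_algebra fscale fvac Y
  for zscale :: "int \<Rightarrow> 'l::ab_group_add \<Rightarrow> 'l"
    and b :: "'n::finite \<Rightarrow> 'l"
    and form :: "'l \<Rightarrow> 'l \<Rightarrow> int"
    and Y :: "('n, 'l) fock \<Rightarrow> int \<Rightarrow> ('n, 'l) fock \<Rightarrow> ('n, 'l) fock" +
  fixes \<epsilon> :: "'l \<Rightarrow> 'l \<Rightarrow> complex"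
  assumes cocycle_values: "\<epsilon> \<alpha> \<beta> \<in> {1, - 1}"
    and cocycle_left: "\<epsilon> (\<alpha> + \<alpha>') \<beta> = \<epsilon> \<alpha> \<beta> * \<epsilon> \<alpha>' \<beta>"
    and cocycle_right: "\<epsilon> \<alpha> (\<beta> + \<beta>') = \<epsilon> \<alpha> \<beta> * \<epsilon> \<alpha> \<beta>'"
    and cocycle_comm: "\<epsilon> \<alpha> \<beta> * \<epsilon> \<beta> \<alpha> = (- 1) powi form \<alpha> \<beta>"
    and Y_heis: "Y (heis h (- 1) fvac) n v = heis h n v"
    and Y_exp: "Y (fexp \<alpha>) n v = vertex_op \<epsilon> \<alpha> n v"

end

(* A nondegenerate lattice that is not positive-definite has vectors alpha of arbitrarily negative
   norm. For these, Y(e^alpha,x)e^(-alpha) starts with a nonzero multiple of 1 in the large degree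
   -<alpha,alpha>, so 1 = u_(-N) v with N arbitrarily large. Expanding (u_(-N) v)_(-1) w by the
   iterate formula puts every w into C_N. In a lower truncated grading, u_(-N) v has only components
   of positive degree once N is large, whereas 1 has degree 0. *)

theory Submission
  imports Defs
begin

section \<open>Consequences of the Borcherds identity for \<open>C_space\<close> and
  \<open>E_space\<close>\<close>

context vertex_algebra
begin

lemma prod_zero_left [simp]: "prod 0 n v = 0"
  using prod_scale_left[of 0 0 n v] by simp

lemma prod_zero_right [simp]: "prod u n 0 = 0"
  using prod_scale_right[of u n 0 0] by simp

lemma prod_sum_left: "prod (sum f A) n v = (\<Sum>a\<in>A. prod (f a) n v)"
  by (induction A rule: infinite_finite_induct) (auto simp: prod_add_left)

lemma prod_sum_right: "prod u n (sum f A) = (\<Sum>a\<in>A. prod u n (f a))"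
  by (induction A rule: infinite_finite_induct) (auto simp: prod_add_right)

text \<open>This is \<open>borcherds\<close> at m = 0: the coefficient (0 choose i) leaves only the
  term i = 0 on the left-hand side.\<close>

lemma iterate_formula:
  "prod (prod u l v) n w =
     Sum_any (\<lambda>i::nat. scale ((-1) ^ i * (of_int l gchoose i))
       (prod u (l - int i) (prod v (n + int i) w)
        - scale ((-1) powi l) (prod v (n + l - int i) (prod u (int i) w))))"
proof -
  have "scale (of_int 0 gchoose i) (prod (prod u (l + int i) v) (0 + n - int i) w)
      = (if i = 0 then prod (prod u l v) n w else 0)" for i :: nat
    by (cases i) auto
  then have "Sum_any (\<lambda>i::nat. scale (of_int 0 gchoose i)
      (prod (prod u (l + int i) v) (0 + n - int i) w)) = prod (prod u l v) n w"
    by (simp add: Sum_any.delta)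
  with borcherds[of 0 u l v n w] show ?thesis
    by simp
qed

text \<open>The vector \<open>u\<^sub>-\<^sub>2 \<^bold>1\<close> is the derivative of \<open>u\<close>.\<close>

lemma prod_derivative:
  "prod (prod u (-2) vac) (- int (Suc k)) w = scale (of_nat (Suc k)) (prod u (- 2 - int k) w)"
proof -
  have binom: "(-1) ^ k * ((- 2 :: complex) gchoose k) = of_nat (Suc k)"
  proof -
    have "(- 2 :: complex) gchoose k = (-1) ^ k * (of_nat (Suc k) gchoose k)"
      by (subst gbinomial_negated_upper) simp
    also have "(of_nat (Suc k) :: complex) gchoose k = of_nat (Suc k)"
      by (metis binomial_gbinomial binomial_Suc_n)
    finally show ?thesis
      by (simp flip: power_mult_distrib mult.assoc)
  qed
  \<comment> \<open>A mode of \<open>vac\<close> survives only at index -1. In the first product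
    this forces i = k; in the second the index is at most -3, so that product always
    vanishes.\<close>
  have "scale ((-1) ^ i * (of_int (-2) gchoose i))
       (prod u (-2 - int i) (prod vac (- int (Suc k) + int i) w)
        - scale ((-1) powi (-2)) (prod vac (- int (Suc k) + -2 - int i) (prod u (int i) w)))
      = (if i = k then scale (of_nat (Suc k)) (prod u (- 2 - int k) w) else 0)" for i :: nat
    using binom by (auto simp: vacuum algebra_simps)
  then show ?thesis
    by (subst iterate_formula) (simp add: Sum_any.delta)
qed

lemma prod_in_C_space: "prod u (- int n) v \<in> C_space n"
  unfolding C_space_def by (rule span_base) blast

lemma subspace_C_space: "subspace (C_space n)"
  unfolding C_space_def by (rule subspace_span)

text \<open>By \<open>prod_derivative\<close>, lowering the mode index by one costs only the factor
  n + 1, which is invertible over the complex numbers.\<close>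

lemma C_space_Suc_subset: "C_space (Suc (Suc n)) \<subseteq> C_space (Suc n)"
proof -
  have "prod u (- int (Suc (Suc n))) v \<in> C_space (Suc n)" for u v
  proof -
    have eq: "- int (Suc (Suc n)) = - 2 - int n"
      by simp
    have "prod u (- int (Suc (Suc n))) v
        = scale (inverse (of_nat (Suc n))) (prod (prod u (-2) vac) (- int (Suc n)) v)"
      unfolding prod_derivative eq by (simp del: of_nat_Suc)
    then show ?thesis
      using subspace_scale[OF subspace_C_space prod_in_C_space] by presburger
  qed
  then show ?thesis
    unfolding C_space_def[of "Suc (Suc n)"]
    by (intro span_minimal subspace_C_space) auto
qed

lemma C_space_antimono:
  assumes "1 \<le> m" "m \<le> n"
  shows "C_space n \<subseteq> C_space m"
  using \<open>m \<le> n\<close>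
proof (induction n rule: dec_induct)
  case (step k)
  then obtain j where "k = Suc j"
    using \<open>1 \<le> m\<close> by (cases k) auto
  with C_space_Suc_subset[of j] step show ?case
    by auto
qed simp

lemma subspace_Sum_any:
  assumes "subspace S" "\<And>i. f i \<in> S"
  shows "Sum_any f \<in> S"
  unfolding Sum_any.expand_set using assms by (auto intro: subspace_sum)

lemma C_space_eq_UNIV:
  assumes vac: "vac = scale c (prod u (- int N) v)" and "1 \<le> n" "n \<le> N"
  shows "C_space n = UNIV"
proof -
  have in_C: "prod a (- int k) w \<in> C_space n" if "n \<le> k" for a k w
    using prod_in_C_space C_space_antimono[OF \<open>1 \<le> n\<close> that] by blast
  \<comment> \<open>The facts \<open>left\<close> and \<open>right\<close> cover the outermost modes
    of the two families of terms in the iterate formula for (u_(-N) v)_(-1) w. All their indices are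
    at most -N, hence at most -n.\<close>
  have left: "prod a (- int N - int i) w \<in> C_space n" for a i w
    using in_C[of "N + i" a w] \<open>n \<le> N\<close> by (simp add: algebra_simps)
  have right: "prod a (-1 + - int N - int i) w \<in> C_space n" for a i w
    using in_C[of "Suc (N + i)" a w] \<open>n \<le> N\<close> by (simp add: algebra_simps)
  have "w \<in> C_space n" for w
  proof -
    have "prod (prod u (- int N) v) (-1) w \<in> C_space n"
      by (subst iterate_formula)
        (intro subspace_Sum_any subspace_C_space subspace_scale subspace_diff left right)
    moreover have "w = scale c (prod (prod u (- int N) v) (-1) w)"
      using vacuum[of "-1" w] unfolding vac by (simp add: prod_scale_left)
    ultimately show ?thesis
      using subspace_scale[OF subspace_C_space] by metis
  qed
  then show ?thesis
    by blast
qed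

lemma C_space_subset_E_space: "C_space (n + 2) \<subseteq> E_space (int n)"
  unfolding C_space_def E_space_def
proof (rule span_mono, safe)
  fix u v
  \<comment> \<open>Since -(n+2) = -1 - (n+1), a single factor with k = n + 1 suffices, one more
    than \<open>E_space\<close> requires.\<close>
  have "prod u (- int (n + 2)) v = foldr (\<lambda>(u, k). prod u (- 1 - int k)) [(u, Suc n)] v"
    by (simp add: algebra_simps)
  moreover have "[(u, Suc n)] \<noteq> []" "int (sum_list (map snd [(u, Suc n)])) \<ge> int n"
    by simp_all
  ultimately show "\<exists>uks va. prod u (- int (n + 2)) v = foldr (\<lambda>(u, k). prod u (- 1 - int k)) uks va
      \<and> uks \<noteq> [] \<and> int n \<le> int (sum_list (map snd uks))"
    by blast
qed

end

section \<open>Degrees in a lower truncated grading\<close>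

lemma (in graded_vertex_algebra) homogeneous_decomposition_unique:
  assumes "\<And>n. f n \<in> G n" "finite {n. f n \<noteq> 0}" "v = (\<Sum>n | f n \<noteq> 0. f n)" and "v \<in> G m"
  shows "f = (\<lambda>n. if n = m then v else 0)"
proof -
  define decomposes where "decomposes f \<longleftrightarrow>
    (\<forall>n. f n \<in> G n) \<and> finite {n. f n \<noteq> 0} \<and> v = (\<Sum>n | f n \<noteq> 0. f n)" for f
  let ?g = "\<lambda>n. if n = m then v else 0"
  \<comment> \<open>Only an inclusion, because v may be 0.\<close>
  have supp: "{n. ?g n \<noteq> 0} \<subseteq> {m}"
    by auto
  then have "finite {n. ?g n \<noteq> 0}"
    by (rule finite_subset) simp
  moreover have "v = (\<Sum>n | ?g n \<noteq> 0. ?g n)"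
    using supp by (subst sum.mono_neutral_left[of "{m}"]) auto
  moreover have "\<forall>n. ?g n \<in> G n"
    using \<open>v \<in> G m\<close> subspace_0[OF graded_subspace] by auto
  ultimately have "decomposes ?g"
    unfolding decomposes_def by blast
  moreover have "decomposes f"
    unfolding decomposes_def using assms(1-3) by blast
  moreover have "\<exists>!f. decomposes f"
    unfolding decomposes_def by (rule graded_direct_sum)
  ultimately show ?thesis
    by blast
qed

lemma (in lower_truncated_graded_vertex_algebra) vac_not_deep_product:
  assumes "vac \<noteq> 0"
  shows "\<exists>N. \<forall>n\<ge>N. \<forall>u v c. vac \<noteq> scale c (prod u (- int n) v)"
proof -
  obtain K where K: "\<And>n. n < K \<Longrightarrow> G n = {0}"
    using lower_truncated by blast
  \<comment> \<open>Components of u and v live in degrees at least K, so their products have degree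
    at least 2K + n - 1, which is at least 1 for these n.\<close>
  have "vac \<noteq> scale c (prod u (- int n) v)" if n: "n \<ge> nat (2 - 2 * K)" for n u v c
  proof
    assume eq: "vac = scale c (prod u (- int n) v)"
    obtain f where f: "\<And>n. f n \<in> G n" "finite {n. f n \<noteq> 0}" "u = (\<Sum>n | f n \<noteq> 0. f n)"
      using graded_direct_sum[of u] by blast
    obtain g where g: "\<And>n. g n \<in> G n" "finite {n. g n \<noteq> 0}" "v = (\<Sum>n | g n \<noteq> 0. g n)"
      using graded_direct_sum[of v] by blast
    define I where "I = {n. f n \<noteq> 0} \<times> {n. g n \<noteq> 0}"
    define deg where "deg = (\<lambda>(i, j). j + i + int n - 1)"
    define t where "t = (\<lambda>(i, j). scale c (prod (f i) (- int n) (g j)))"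
    \<comment> \<open>Several pairs (i, j) can share a degree, so the terms are collected by degree
      before uniqueness of the decomposition is applied to \<open>vac\<close>.\<close>
    define h where "h d = (\<Sum>p\<in>{p \<in> I. deg p = d}. t p)" for d
    have fin: "finite I"
      using f g by (simp add: I_def)
    have t: "t p \<in> G (deg p)" for p
      using prod_graded[OF f(1) g(1), of "fst p" "- int n" "snd p"]
      by (auto simp: t_def deg_def split: prod.splits intro!: subspace_scale graded_subspace)
    have hG: "h d \<in> G d" for d
      unfolding h_def using t by (intro subspace_sum graded_subspace) auto
    have supp: "{d. h d \<noteq> 0} \<subseteq> deg ` I"
    proof
      fix d assume "d \<in> {d. h d \<noteq> 0}"
      then have "{p \<in> I. deg p = d} \<noteq> {}"
        unfolding h_def by (metis (mono_tags, lifting) mem_Collect_eq sum.empty)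
      then show "d \<in> deg ` I"
        by auto
    qed
    have pos: "deg p > 0" if p_in: "p \<in> I" for p
    proof -
      obtain i j where p: "p = (i, j)" "f i \<noteq> 0" "g j \<noteq> 0"
        using p_in by (auto simp: I_def)
      have "\<not> i < K" "\<not> j < K"
        using K f(1)[of i] g(1)[of j] p by auto
      with n show ?thesis
        by (simp add: p deg_def)
    qed
    have "vac = (\<Sum>p\<in>I. t p)"
      unfolding eq f(3) g(3) I_def t_def
      by (subst prod_sum_left)
        (simp only: prod_sum_right scale_sum_right sum.cartesian_product case_prod_unfold)
    also have "\<dots> = (\<Sum>d\<in>deg ` I. h d)"
      unfolding h_def by (rule sum.image_gen[OF fin])
    also have "\<dots> = (\<Sum>d | h d \<noteq> 0. h d)"
      using supp fin by (intro sum.mono_neutral_right) auto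
    finally have "h = (\<lambda>d. if d = 0 then vac else 0)"
      using hG supp fin vac_graded
      by (intro homogeneous_decomposition_unique) (auto intro: finite_subset)
    then have "h 0 = vac"
      by simp
    then have "0 \<in> deg ` I"
      using assms supp by auto
    then show False
      using pos by force
  qed
  then show ?thesis
    by blast
qed

section \<open>Vectors of negative norm\<close>

context even_lattice
begin

lemma form_zero_left [simp]: "form 0 \<beta> = 0"
  using form_add[of 0 0 \<beta>] by simp

lemma form_minus_left: "form (- \<alpha>) \<beta> = - form \<alpha> \<beta>"
  using form_add[of "- \<alpha>" \<alpha> \<beta>] by simp

lemma form_add_right: "form \<alpha> (\<beta> + \<beta>') = form \<alpha> \<beta> + form \<alpha> \<beta>'"
  using form_add form_sym by metis

text \<open>If the nonzero vector \<alpha> violating positivity is isotropic, nondegeneracy supplies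
  \<beta> pairing negatively with it, and the norm of \<beta> + k\<alpha> decreases linearly in
  k.\<close>

lemma exists_negative_norm:
  assumes "nondegenerate form" "\<not> positive_definite form"
  obtains \<alpha> where "form \<alpha> \<alpha> < 0"
proof -
  obtain \<alpha> where "\<alpha> \<noteq> 0" "form \<alpha> \<alpha> \<le> 0"
    using assms(2) by (auto simp: positive_definite_def not_less)
  show thesis
  proof (cases "form \<alpha> \<alpha> = 0")
    case False
    with \<open>form \<alpha> \<alpha> \<le> 0\<close> that show thesis
      by (meson order_le_neq_trans)
  next
    case True
    obtain \<beta>' where "form \<beta>' \<alpha> \<noteq> 0"
      using assms(1) \<open>\<alpha> \<noteq> 0\<close> form_sym unfolding nondegenerate_def by metis
    then obtain \<beta> where \<beta>: "form \<beta> \<alpha> \<le> - 1"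
      using form_minus_left[of \<beta>' \<alpha>] by (metis linorder_neqE_linordered_idom
        int_one_le_iff_zero_less minus_le_iff neg_0_less_iff_less minus_minus)
    \<comment> \<open>The witness is \<beta> + k\<alpha>. Its pairing with \<alpha> stays fixed
      since \<alpha> is isotropic, so each step changes the norm by twice that pairing, at most
      -2.\<close>
    have "\<exists>\<gamma>. form \<gamma> \<alpha> = form \<beta> \<alpha> \<and> form \<gamma> \<gamma> \<le> form \<beta> \<beta> - int k" for k
    proof (induction k)
      case 0
      show ?case by auto
    next
      case (Suc k)
      then obtain \<gamma> where \<gamma>: "form \<gamma> \<alpha> = form \<beta> \<alpha>" "form \<gamma> \<gamma> \<le> form \<beta> \<beta> - int k"
        by auto
      with \<beta> True form_sym[of \<alpha> \<gamma>] show ?case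
        by (intro exI[of _ "\<gamma> + \<alpha>"]) (simp add: form_add form_add_right)
    qed
    from this[of "nat (form \<beta> \<beta>) + 1"] obtain \<gamma> where
      "form \<gamma> \<gamma> \<le> form \<beta> \<beta> - int (nat (form \<beta> \<beta>) + 1)"
      by blast
    then have "form \<gamma> \<gamma> < 0"
      by linarith
    then show thesis
      by (rule that)
  qed
qed

lemma exists_very_negative_norm:
  assumes "nondegenerate form" "\<not> positive_definite form"
  shows "\<exists>\<alpha>. form \<alpha> \<alpha> \<le> - int (Suc N)"
proof (induction N)
  case 0
  obtain \<alpha> where "form \<alpha> \<alpha> < 0"
    using exists_negative_norm[OF assms] .
  then show ?case
    by (intro exI[of _ \<alpha>]) simp
next
  case (Suc N)
  then obtain \<alpha> where "form \<alpha> \<alpha> \<le> - int (Suc N)" ..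
  then show ?case
    \<comment> \<open>Doubling multiplies the negative norm by 4.\<close>
    by (intro exI[of _ "\<alpha> + \<alpha>"]) (simp add: form_add form_add_right)
qed

end

section \<open>The leading coefficient of a lattice vertex operator\<close>

interpretation fock: vector_space fscale
  by (rule vector_space_fscale)

lemma linear_extension_eq_0:
  assumes "\<And>M \<beta>. (M, \<beta>) \<in> Poly_Mapping.keys v \<Longrightarrow> f M \<beta> = 0"
  shows "linear_extension f v = 0"
  unfolding linear_extension_def using assms by (intro sum.neutral) auto

lemma linear_extension_fbasis [simp]: "linear_extension f (fbasis M \<beta>) = f M \<beta>"
  by (simp add: linear_extension_def fbasis_def)

lemma keys_fscale_fbasis: "Poly_Mapping.keys (fscale c (fbasis M \<beta>)) \<subseteq> {(M, \<beta>)}"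
  by (auto simp: fbasis_def in_keys_iff lookup_single when_def split: if_splits)

lemma fvac_neq_0: "fvac \<noteq> 0"
  unfolding fvac_def fexp_def fbasis_def
  by (metis lookup_single_eq lookup_zero zero_neq_one)

lemma exp_coeff_0 [simp]: "exp_coeff a 0 v = v"
proof -
  have "{ns::nat list. 0 \<notin> set ns \<and> sum_list ns = 0} = {[]}"
    by (auto simp: sum_list_eq_0_iff) (metis list.set_intros(1) neq_Nil_conv)
  then show ?thesis
    by (simp add: exp_coeff_def)
qed

text \<open>Every list summing to k > 0 is nonempty, so its innermost operator kills v. That the
  remaining ones preserve 0 is a separate hypothesis because \<open>a\<close> is not assumed
  linear.\<close>

lemma exp_coeff_eq_0:
  assumes "\<And>n. n > 0 \<Longrightarrow> a n 0 = 0" "\<And>n. n > 0 \<Longrightarrow> a n v = 0" "k > 0"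
  shows "exp_coeff a k v = 0"
proof -
  have "foldr a ns v = 0" if "0 \<notin> set ns" "ns \<noteq> []" for ns
    using that
  proof (induction ns)
    case (Cons n ns)
    then show ?case
      using assms(1,2) by (cases "ns = []") auto
  qed simp
  then show ?thesis
    unfolding exp_coeff_def using \<open>k > 0\<close> by (intro sum.neutral) force
qed

context even_lattice
begin

lemma heis_0 [simp]: "heis h m 0 = 0"
  unfolding heis_def by (rule linear_extension_eq_0) simp

lemma heis_pos_fexp: "m > 0 \<Longrightarrow> heis h m (fscale c (fbasis {#} \<beta>)) = 0"
  unfolding heis_def using keys_fscale_fbasis[of c "{#}" \<beta>]
  by (intro linear_extension_eq_0) auto

lemma exp_minus_0_right [simp]: "exp_minus \<alpha> k 0 = 0"
  by (cases "k = 0") (auto simp: exp_minus_def intro: exp_coeff_eq_0)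

lemma exp_minus_0_left [simp]: "exp_minus \<alpha> 0 v = v"
  by (simp add: exp_minus_def)

lemma exp_plus_fexp:
  "exp_plus \<alpha> k (fscale c (fbasis {#} \<beta>)) = (if k = 0 then fscale c (fbasis {#} \<beta>) else 0)"
  by (auto simp: exp_plus_def heis_pos_fexp intro!: exp_coeff_eq_0)

text \<open>This index selects the power x^<\<alpha>,\<beta>>, so the condition in
  \<open>vertex_op\<close> becomes j = k. Annihilation operators kill exponentials, hence k = 0 and
  both exponential factors contribute the identity.\<close>

lemma vertex_op_leading:
  "vertex_op \<epsilon> \<alpha> (- form \<alpha> \<beta> - 1) (fexp \<beta>) = fscale (\<epsilon> \<alpha> \<beta>) (fexp (\<alpha> + \<beta>))"
proof -
  have "(\<lambda>(j, k). if int j - int k + form \<alpha> \<beta> = - (- form \<alpha> \<beta> - 1) - 1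
       then exp_minus \<alpha> j (exp_plus \<alpha> k (fscale (\<epsilon> \<alpha> \<beta>) (fbasis {#} (\<alpha> + \<beta>)))) else 0)
     = (\<lambda>p. if p = (0, 0) then fscale (\<epsilon> \<alpha> \<beta>) (fexp (\<alpha> + \<beta>)) else 0)"
    by (auto simp: fun_eq_iff exp_plus_fexp fexp_def)
  then show ?thesis
    unfolding vertex_op_def fexp_def[of \<beta>] linear_extension_fbasis
    by (simp add: Sum_any.delta)
qed

end

section \<open>The vacuum as an arbitrarily deep product, and the conclusion\<close>

lemma (in lattice_vertex_algebra) vac_deep_product:
  assumes "nondegenerate form" "\<not> positive_definite form"
  obtains n u v c where "n \<ge> N" "fvac = fscale c (Y u (- int n) v)"
proof -
  obtain \<alpha> where \<alpha>: "form \<alpha> \<alpha> \<le> - int (Suc N)"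
    using exists_very_negative_norm[OF assms] ..
  \<comment> \<open>Chosen so that -n is the leading index of \<open>vertex_op_leading\<close> at
    \<beta> = -\<alpha>, where the exponents cancel and a multiple of \<open>fvac\<close>
    results.\<close>
  define n where "n = nat (1 - form \<alpha> \<alpha>)"
  have "form \<alpha> (- \<alpha>) = - form \<alpha> \<alpha>"
    using form_minus_left form_sym by metis
  with \<alpha> have n: "- int n = - form \<alpha> (- \<alpha>) - 1"
    by (simp add: n_def)
  have "Y (fexp \<alpha>) (- int n) (fexp (- \<alpha>)) = fscale (\<epsilon> \<alpha> (- \<alpha>)) fvac"
    unfolding Y_exp n vertex_op_leading by (simp add: fvac_def)
  \<comment> \<open>The cocycle value is a sign, hence its own inverse, and can serve as the
    constant c.\<close>
  moreover have "\<epsilon> \<alpha> (- \<alpha>) * \<epsilon> \<alpha> (- \<alpha>) = 1"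
    using cocycle_values[of \<alpha> "- \<alpha>"] by auto
  ultimately have "fvac = fscale (\<epsilon> \<alpha> (- \<alpha>)) (Y (fexp \<alpha>) (- int n) (fexp (- \<alpha>)))"
    by simp
  moreover have "n \<ge> N"
    using \<alpha> by (simp add: n_def)
  ultimately show thesis
    using that by blast
qed

theorem proposition3p12:
  fixes zscale :: "int \<Rightarrow> 'l::ab_group_add \<Rightarrow> 'l"
    and b :: "'n::finite \<Rightarrow> 'l"
    and form :: "'l \<Rightarrow> 'l \<Rightarrow> int"
    and \<epsilon> :: "'l \<Rightarrow> 'l \<Rightarrow> complex"
    and Y :: "('n, 'l) fock \<Rightarrow> int \<Rightarrow> ('n, 'l) fock \<Rightarrow> ('n, 'l) fock"
  assumes "even_lattice zscale b form"
    and "nondegenerate form"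
    and "\<not> positive_definite form"
    and "lattice_vertex_algebra zscale b form Y \<epsilon>"
  shows "(\<forall>n::nat. vertex_algebra.C_space fscale Y (n + 2) = vertex_algebra.E_space fscale Y (int n)
                 \<and> vertex_algebra.E_space fscale Y (int n) = UNIV)
       \<and> \<not> (\<exists>G. lower_truncated_graded_vertex_algebra fscale fvac Y G)"
proof -
  interpret lattice_vertex_algebra zscale b form Y \<epsilon>
    by (fact assms(4))
  have "VL.C_space (n + 2) = UNIV" for n
  proof -
    obtain N u v c where "N \<ge> n + 2" "fvac = fscale c (Y u (- int N) v)"
      using vac_deep_product[OF assms(2,3)] .
    then show ?thesis
      by (intro VL.C_space_eq_UNIV) auto
  qed
  \<comment> \<open>\<open>E_space\<close> is squeezed between \<open>C_space\<close> and the whole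
    space.\<close>
  moreover from this have "VL.E_space (int n) = UNIV" for n
    using VL.C_space_subset_E_space[of n] by auto
  moreover have "\<not> lower_truncated_graded_vertex_algebra fscale fvac Y G" for G
  proof
    assume "lower_truncated_graded_vertex_algebra fscale fvac Y G"
    then interpret lower_truncated_graded_vertex_algebra fscale fvac Y G .
    obtain N where "\<forall>n\<ge>N. \<forall>u v c. fvac \<noteq> fscale c (Y u (- int n) v)"
      using vac_not_deep_product[OF fvac_neq_0] ..
    then show False
      using vac_deep_product[OF assms(2,3)] by metis
  qed
  ultimately show ?thesis
    by blast
qed

end
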